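(* Let $d\in\mathbb N$, $\mathbf x_0\in\mathbb R^d$, and $\gamma,p\in\mathbb N$ with $p\ge\gamma$. Let $\mathcal L$ be a linear partial differential operator of order $\gamma$ with variable coefficients in $\mathcal C^{p-\gamma}$. For any function $u\in\mathcal C^{p+\gamma}$ such that $\mathcal L u=0$ in a neighborhood of $\mathbf x_0$, there exists a quasi-Trefftz function $u_a\in\mathbb{QT}_p$ such that, for all $\mathbf x$ in a neighborhood of $\mathbf x_0$, $$|u(\mathbf x)-u_a(\mathbf x)|\le C|\mathbf x-\mathbf x_0|^{p+1}\quad\text{and}\quad |\nabla u(\mathbf x)-\nabla u_a(\mathbf x)|\le C|\mathbf x-\mathbf x_0|^{p},$$ for some constant $C$ independent of $\mathbf x$, but depending on $u$, $\mathbf x_0$ and $p$.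
   Context: Functions are $\mathbb K$-valued with $\mathbb K=\mathbb R$ or $\mathbb C$. $\mathbb N$ is the set of positive integers, $\mathbb N_0=\mathbb N\cup\{0\}$. For $n\in\mathbb N_0$, $\mathcal C^n$ denotes the space of functions with continuous derivatives up to order $n$ in a neighborhood of $\mathbf x_0$. $\mathbb P_p$ is the space of polynomials in $d$ variables of degree at most $p$ over $\mathbb K$. For $\varphi\in\mathcal C^k$, its $k$th Taylor polynomial at $\mathbf x_0$ is $T_k[\varphi]=\sum_{l=0}^k\sum_{|\mathbf i|=l}\frac1{\mathbf i!}\partial^{\mathbf i}\varphi(\mathbf x_0)(\mathbf X-\mathbf x_0)^{\mathbf i}\in\mathbb P_k$. The operator has the form $\mathcal L=\sum_{m=0}^\gamma\sum_{|\mathbf j|=m}c_{\mathbf j}(\mathbf x)\partial_{\mathbf x}^{\mathbf j}$. The quasi-Trefftz space of order $p$ is $\mathbb{QT}_p=\{\Pi\in\mathbb P_p : T_{p-\gamma}[\mathcal L\Pi]=0\}$. *)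

theory Defs
  imports "HOL-Analysis.Analysis"
begin

text \<open>
  Functions on \<open>\<real>\<^sup>d\<close> are total functions on \<^typ>\<open>real^'d\<close>. They take values in a type
  \<open>'k\<close> of sort \<open>{real_normed_field, euclidean_space}\<close>: a finite-dimensional real normed field
  (commutative, with multiplicative norm), hence \<open>\<real>\<close> or \<open>\<complex>\<close> with the usual absolute value
  up to isomorphism. Multi-indices are functions \<^typ>\<open>'d \<Rightarrow> nat\<close>.
\<close>

definition mi_abs :: "('d::finite \<Rightarrow> nat) \<Rightarrow> nat"
  where "mi_abs j = (\<Sum>i\<in>UNIV. j i)"

definition mi_fact :: "('d::finite \<Rightarrow> nat) \<Rightarrow> real"
  where "mi_fact j = (\<Prod>i\<in>UNIV. fact (j i))"

definition mi_pow :: "real^'d \<Rightarrow> ('d::finite \<Rightarrow> nat) \<Rightarrow> real"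
  where "mi_pow x j = (\<Prod>i\<in>UNIV. (x $ i) ^ j i)"

lemma finite_mi_abs_le: "finite {j :: 'd::finite \<Rightarrow> nat. mi_abs j \<le> m}"
proof (rule finite_subset)
  show "{j :: 'd \<Rightarrow> nat. mi_abs j \<le> m} \<subseteq> (UNIV :: 'd set) \<rightarrow>\<^sub>E {..m}"
  proof
    fix j :: "'d \<Rightarrow> nat" assume "j \<in> {j. mi_abs j \<le> m}"
    then have m: "(\<Sum>i\<in>UNIV. j i) \<le> m" by (simp add: mi_abs_def)
    have "j i \<le> m" for i
      using member_le_sum[of i UNIV j] m by simp
    then show "j \<in> UNIV \<rightarrow>\<^sub>E {..m}" by (simp add: PiE_UNIV_domain)
  qed
  show "finite ((UNIV :: 'd set) \<rightarrow>\<^sub>E {..m})" by (intro finite_PiE) auto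
qed

lemma finite_mi_abs_eq: "finite {j :: 'd::finite \<Rightarrow> nat. mi_abs j = m}"
  by (rule finite_subset[OF _ finite_mi_abs_le[of m]]) auto

definition partial_differentiable ::
    "'d \<Rightarrow> (real^'d \<Rightarrow> 'k::real_normed_vector) \<Rightarrow> real^'d::finite \<Rightarrow> bool"
  where "partial_differentiable i f x \<longleftrightarrow> (\<lambda>t. f (x + t *\<^sub>R axis i 1)) differentiable (at (0::real))"

definition partial ::
    "'d \<Rightarrow> (real^'d \<Rightarrow> 'k::real_normed_vector) \<Rightarrow> real^'d::finite \<Rightarrow> 'k"
  where "partial i f x = vector_derivative (\<lambda>t. f (x + t *\<^sub>R axis i 1)) (at 0)"

definition grad :: "(real^'d \<Rightarrow> 'k::real_normed_vector) \<Rightarrow> real^'d::finite \<Rightarrow> 'k^'d"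
  where "grad f x = (\<chi> i. partial i f x)"

text \<open>
  The derivative for a multi-index \<open>j\<close> is taken along some list of directions in which each
  \<open>i\<close> occurs \<open>j i\<close> times. The order of the list is immaterial for functions having continuous
  derivatives up to the total order of \<open>j\<close>, which are the only ones it is applied to.
\<close>

definition mi_partial ::
    "('d \<Rightarrow> nat) \<Rightarrow> (real^'d \<Rightarrow> 'k::real_normed_vector) \<Rightarrow> real^'d::finite \<Rightarrow> 'k"
  where "mi_partial j f = foldr partial (SOME is. \<forall>i. count_list is i = j i) f"

primrec Cn_on :: "nat \<Rightarrow> (real^'d) set \<Rightarrow> (real^'d::finite \<Rightarrow> 'k::real_normed_vector) \<Rightarrow> bool"
  where
    "Cn_on 0 U f \<longleftrightarrow> continuous_on U f"
  | "Cn_on (Suc n) U f \<longleftrightarrow> continuous_on U f \<and>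
       (\<forall>i. (\<forall>x\<in>U. partial_differentiable i f x) \<and> Cn_on n U (partial i f))"

definition Cn :: "nat \<Rightarrow> real^'d::finite \<Rightarrow> (real^'d \<Rightarrow> 'k::real_normed_vector) set"
  where "Cn n x0 = {f. \<exists>U. open U \<and> x0 \<in> U \<and> Cn_on n U f}"

text \<open>Since the real field is infinite, polynomials are identified with polynomial functions.\<close>

definition polys :: "nat \<Rightarrow> (real^'d::finite \<Rightarrow> 'k::{real_normed_field, euclidean_space}) set"
  where "polys p = {\<lambda>x. \<Sum>j | mi_abs j \<le> p. mi_pow x j *\<^sub>R a j | a. True}"

definition taylor ::
    "nat \<Rightarrow> real^'d::finite \<Rightarrow> (real^'d \<Rightarrow> 'k::{real_normed_field, euclidean_space}) \<Rightarrow> real^'d \<Rightarrow> 'k"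
  where "taylor k x0 f = (\<lambda>x. \<Sum>l=0..k. \<Sum>i | mi_abs i = l.
           (1 / mi_fact i) *\<^sub>R (mi_pow (x - x0) i *\<^sub>R mi_partial i f x0))"

definition diff_op ::
    "nat \<Rightarrow> (('d::finite \<Rightarrow> nat) \<Rightarrow> real^'d \<Rightarrow> 'k::{real_normed_field, euclidean_space}) \<Rightarrow>
      (real^'d \<Rightarrow> 'k) \<Rightarrow> real^'d \<Rightarrow> 'k"
  where "diff_op \<gamma> c f = (\<lambda>x. \<Sum>m=0..\<gamma>. \<Sum>j | mi_abs j = m. c j x * mi_partial j f x)"

definition quasi_trefftz ::
    "nat \<Rightarrow> nat \<Rightarrow> (('d::finite \<Rightarrow> nat) \<Rightarrow> real^'d \<Rightarrow> 'k::{real_normed_field, euclidean_space}) \<Rightarrow>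
      real^'d \<Rightarrow> (real^'d \<Rightarrow> 'k) set"
  where "quasi_trefftz p \<gamma> c x0 = {f \<in> polys p. taylor (p - \<gamma>) x0 (diff_op \<gamma> c f) = (\<lambda>x. 0)}"

end

theory Submission
  imports Defs
begin

text \<open>
  The approximant is the Taylor polynomial of \<open>u\<close> of degree \<open>p\<close> at \<open>x0\<close>. It depends on neither the
  operator nor its order, and therefore neither does the constant in the estimates.

  Let \<open>w\<close> be the difference of the Taylor polynomial and \<open>u\<close>. All derivatives of \<open>w\<close> up to order \<open>p\<close>
  vanish at \<open>x0\<close> (\<open>taylor_remainder_vanishes\<close>). Everything follows from this in two ways.

  First, derivatives of order at most \<open>\<gamma>\<close> of \<open>w\<close> still vanish to order \<open>p - \<gamma>\<close>, and by the product rule so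
  do their products with coefficients of class \<open>C\<^sup>p\<^sup>-\<^sup>\<gamma>\<close> (\<open>vanishes_to_order_mult\<close>). Hence the operator
  sends \<open>w\<close> to a function that vanishes to order \<open>p - \<gamma>\<close>. As the operator annihilates \<open>u\<close> near \<open>x0\<close>,
  this function is also the image of the Taylor polynomial, which is therefore quasi-Trefftz
  (\<open>taylor_in_quasi_trefftz\<close>).

  Second, a function whose derivatives of order less than \<open>n\<close> vanish at \<open>x0\<close>, and whose derivatives of
  order \<open>n\<close> are continuous, is \<open>O(|x - x0|\<^sup>n)\<close> (\<open>eventually_norm_le_power\<close>). For \<open>w\<close> this holds with
  \<open>n = p + 1\<close>, for its partial derivatives with \<open>n = p\<close>.

  That the Taylor polynomial has the derivatives of \<open>u\<close> at \<open>x0\<close> rests on the symmetry of iterated partial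
  derivatives: those of a polynomial depend only on how often each direction occurs, and the same must be
  known for \<open>u\<close> (\<open>partials_mset_eq\<close>). As smoothness means that iterated partial derivatives exist and are
  continuous, the proofs argue along coordinate axes throughout.
\<close>

section \<open>Partial derivatives\<close>

text \<open>
  A relational form of \<^const>\<open>partial\<close>, so that the usual derivative rules transfer one by one.
  It is an opaque constant because unfolding it exposes \<open>f (x + t *\<^sub>R axis i 1)\<close>, against which
  higher-order unification has too many solutions.
\<close>

definition has_partial ::
    "'d \<Rightarrow> (real^'d \<Rightarrow> 'k::real_normed_vector) \<Rightarrow> 'k \<Rightarrow> real^'d::finite \<Rightarrow> bool"
  where "has_partial i f f' x \<longleftrightarrow> ((\<lambda>t. f (x + t *\<^sub>R axis i 1)) has_vector_derivative f') (at 0)"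

abbreviation partials ::
    "'d list \<Rightarrow> (real^'d \<Rightarrow> 'k::real_normed_vector) \<Rightarrow> real^'d::finite \<Rightarrow> 'k"
  where "partials is f \<equiv> foldr partial is f"

lemma has_partial_partial: "partial_differentiable i f x \<Longrightarrow> has_partial i f (partial i f x) x"
  unfolding has_partial_def partial_differentiable_def partial_def by (simp add: vector_derivative_works)

lemma has_partialD:
  assumes "has_partial i f f' x"
  shows "partial_differentiable i f x" "partial i f x = f'"
  using assms unfolding has_partial_def partial_differentiable_def partial_def
  by (auto intro: differentiableI_vector vector_derivative_at)

lemma has_vector_derivative_along_axis:
  assumes "partial_differentiable i f (x + s *\<^sub>R axis i 1)"
  shows "((\<lambda>t. f (x + t *\<^sub>R axis i 1)) has_vector_derivative partial i f (x + s *\<^sub>R axis i 1)) (at s)"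
proof -
  have "((\<lambda>t. f (x + s *\<^sub>R axis i 1 + t *\<^sub>R axis i 1)) has_vector_derivative
          partial i f (x + s *\<^sub>R axis i 1)) (at (s - s))"
    using has_partial_partial[OF assms] unfolding has_partial_def by simp
  then have "((\<lambda>t. f (x + s *\<^sub>R axis i 1 + t *\<^sub>R axis i 1)) \<circ> (\<lambda>t. t - s) has_vector_derivative
          1 *\<^sub>R partial i f (x + s *\<^sub>R axis i 1)) (at s)"
    by (intro vector_diff_chain_at) (auto intro!: derivative_eq_intros)
  moreover have "(\<lambda>t. f (x + s *\<^sub>R axis i 1 + t *\<^sub>R axis i 1)) \<circ> (\<lambda>t. t - s)
      = (\<lambda>t. f (x + t *\<^sub>R axis i 1))"
    by (auto simp: fun_eq_iff algebra_simps)
  ultimately show ?thesis by simp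
qed

lemma has_partial_cong_open:
  assumes "has_partial i f f' x" "open U" "x \<in> U" "\<And>y. y \<in> U \<Longrightarrow> f y = g y"
  shows "has_partial i g f' x"
  unfolding has_partial_def
proof (rule has_vector_derivative_transform_within_open[OF assms(1)[unfolded has_partial_def]])
  show "open ((\<lambda>t::real. x + t *\<^sub>R axis i 1) -` U)"
    by (intro open_vimage assms(2) continuous_intros)
qed (use assms in auto)

lemma partial_differentiable_cong_open:
  assumes "open U" "x \<in> U" "\<And>y. y \<in> U \<Longrightarrow> f y = g y"
  shows "partial_differentiable i f x \<longleftrightarrow> partial_differentiable i g x"
proof
  assume "partial_differentiable i f x"
  then show "partial_differentiable i g x"
    by (rule has_partialD(1)[OF has_partial_cong_open[OF has_partial_partial assms(1,2)]])
       (use assms in auto)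
next
  assume "partial_differentiable i g x"
  then show "partial_differentiable i f x"
    by (rule has_partialD(1)[OF has_partial_cong_open[OF has_partial_partial assms(1,2)]])
       (use assms in auto)
qed

lemma partial_cong_open:
  assumes "open U" "x \<in> U" "\<And>y. y \<in> U \<Longrightarrow> f y = g y"
  shows "partial i f x = partial i g x"
proof -
  have "has_partial i f d x \<longleftrightarrow> has_partial i g d x" for d
  proof
    show "has_partial i f d x \<Longrightarrow> has_partial i g d x"
      by (rule has_partial_cong_open[OF _ assms])
    show "has_partial i g d x \<Longrightarrow> has_partial i f d x"
      by (rule has_partial_cong_open[OF _ assms(1,2)]) (simp_all add: assms(3))
  qed
  then show ?thesis unfolding partial_def vector_derivative_def has_partial_def by simp
qed

lemma has_partial_const: "has_partial i (\<lambda>x. c) 0 x"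
  unfolding has_partial_def by (rule has_vector_derivative_const)

lemma has_partial_add:
  "has_partial i f f' x \<Longrightarrow> has_partial i g g' x \<Longrightarrow> has_partial i (\<lambda>x. f x + g x) (f' + g') x"
  unfolding has_partial_def by (rule has_vector_derivative_add)

lemma has_partial_mult:
  fixes f g :: "real^'d::finite \<Rightarrow> 'k::real_normed_algebra"
  shows "has_partial i f f' x \<Longrightarrow> has_partial i g g' x \<Longrightarrow>
    has_partial i (\<lambda>x. f x * g x) (f x * g' + f' * g x) x"
  unfolding has_partial_def by (drule (1) has_vector_derivative_mult) simp

lemma has_partial_bounded_linear:
  "bounded_linear h \<Longrightarrow> has_partial i f f' x \<Longrightarrow> has_partial i (\<lambda>x. h (f x)) (h f') x"
  unfolding has_partial_def by (rule bounded_linear.has_vector_derivative)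

lemma partials_cong_open:
  assumes "open U" "\<And>y. y \<in> U \<Longrightarrow> f y = g y" "x \<in> U"
  shows "partials is f x = partials is g x"
  using assms(3)
proof (induction "is" arbitrary: x)
  case (Cons i "is")
  show ?case using partial_cong_open[OF assms(1) Cons.prems Cons.IH] by simp
qed (use assms in auto)

section \<open>Functions with continuous derivatives up to a given order\<close>

lemma Cn_on_cong_open:
  assumes "open U" "Cn_on n U f" "\<And>y. y \<in> U \<Longrightarrow> f y = g y"
  shows "Cn_on n U g"
  using assms(2,3)
proof (induction n arbitrary: f g)
  case 0
  then show ?case using continuous_on_cong[of U U f g] by auto
next
  case (Suc n)
  have "continuous_on U g" using Suc.prems continuous_on_cong[of U U f g] by auto
  moreover have "partial_differentiable i g x" if "x \<in> U" for i x
    using partial_differentiable_cong_open[OF assms(1) that, of f g] Suc.prems that by auto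
  moreover have "Cn_on n U (partial i g)" for i
    by (rule Suc.IH[of "partial i f"]) (use Suc.prems in \<open>auto intro: partial_cong_open[OF assms(1)]\<close>)
  ultimately show ?case by simp
qed

lemma Cn_on_imp_continuous_on: "Cn_on n U f \<Longrightarrow> continuous_on U f"
  by (cases n) auto

lemma Cn_on_Suc_imp: "Cn_on (Suc n) U f \<Longrightarrow> Cn_on n U f"
  by (induction n arbitrary: f) (auto simp: Cn_on_imp_continuous_on)

lemma Cn_on_mono:
  assumes "Cn_on n U f" "m \<le> n"
  shows "Cn_on m U f"
  using assms(2,1) by (induction rule: dec_induct) (blast dest: Cn_on_Suc_imp)+

lemma Cn_on_subset: "Cn_on n U f \<Longrightarrow> V \<subseteq> U \<Longrightarrow> Cn_on n V f"
  by (induction n arbitrary: f) (auto intro: continuous_on_subset)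

lemma Cn_on_has_partial: "Cn_on (Suc n) U f \<Longrightarrow> x \<in> U \<Longrightarrow> has_partial i f (partial i f x) x"
  by (simp add: has_partial_partial)

lemma Cn_on_SucI:
  assumes "open U" "continuous_on U f" "\<And>i x. x \<in> U \<Longrightarrow> has_partial i f (f' i x) x"
    and "\<And>i. Cn_on n U (f' i)"
  shows "Cn_on (Suc n) U f"
proof -
  have "Cn_on n U (partial i f)" for i
    by (rule Cn_on_cong_open[OF assms(1) assms(4)[of i]]) (rule has_partialD(2)[OF assms(3), symmetric])
  then show ?thesis using assms(2) has_partialD(1)[OF assms(3)] by auto
qed

lemma Cn_on_partials: "Cn_on (length is + n) U f \<Longrightarrow> Cn_on n U (partials is f)"
proof (induction "is" arbitrary: n)
  case (Cons i "is")
  then have "Cn_on (Suc n) U (partials is f)" by (simp del: Cn_on.simps)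
  then show ?case by simp
qed simp

lemma Cn_on_const: "Cn_on n (U :: (real^'d::finite) set) (\<lambda>x. c)"
proof (induction n arbitrary: c)
  case (Suc n)
  have p: "has_partial i (\<lambda>x. c) 0 x" for i :: 'd and x by (rule has_partial_const)
  have "partial i (\<lambda>x. c) = (\<lambda>x. 0)" for i :: 'd using has_partialD(2)[OF p] by auto
  then show ?case using Suc has_partialD(1)[OF p] by auto
qed auto

lemma Cn_on_add:
  assumes "open U" "Cn_on n U f" "Cn_on n U g"
  shows "Cn_on n U (\<lambda>x. f x + g x)"
  using assms(2,3)
proof (induction n arbitrary: f g)
  case (Suc n)
  show ?case
  proof (rule Cn_on_SucI[OF assms(1)])
    show "has_partial i (\<lambda>x. f x + g x) (partial i f x + partial i g x) x" if "x \<in> U" for i x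
      using Suc.prems that by (intro has_partial_add Cn_on_has_partial)
  qed (use Suc in \<open>auto intro: continuous_intros\<close>)
qed (auto intro: continuous_intros)

lemma Cn_on_mult:
  fixes f g :: "real^'d::finite \<Rightarrow> 'k::real_normed_algebra"
  assumes "open U" "Cn_on n U f" "Cn_on n U g"
  shows "Cn_on n U (\<lambda>x. f x * g x)"
  using assms(2,3)
proof (induction n arbitrary: f g)
  case (Suc n)
  show ?case
  proof (rule Cn_on_SucI[OF assms(1)])
    show "has_partial i (\<lambda>x. f x * g x) (f x * partial i g x + partial i f x * g x) x"
      if "x \<in> U" for i x
      using Suc.prems that by (intro has_partial_mult Cn_on_has_partial)
    show "Cn_on n U (\<lambda>x. f x * partial i g x + partial i f x * g x)" for i
      using Suc.prems Suc.prems[THEN Cn_on_Suc_imp] by (intro Cn_on_add assms(1) Suc.IH) auto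
  qed (use Suc in \<open>auto intro: continuous_intros\<close>)
qed (auto intro: continuous_intros)

lemma Cn_on_bounded_linear:
  assumes "open U" "bounded_linear h" "Cn_on n U f"
  shows "Cn_on n U (\<lambda>x. h (f x))"
  using assms(3)
proof (induction n arbitrary: f)
  case 0
  then show ?case using bounded_linear.continuous_on[OF assms(2)] by auto
next
  case (Suc n)
  show ?case
  proof (rule Cn_on_SucI[OF assms(1)])
    show "has_partial i (\<lambda>x. h (f x)) (h (partial i f x)) x" if "x \<in> U" for i x
      using has_partial_bounded_linear[OF assms(2) Cn_on_has_partial[OF Suc.prems that]] .
  qed (use Suc bounded_linear.continuous_on[OF assms(2)] in auto)
qed

lemma partials_bounded_linear:
  assumes "open U" "bounded_linear h" "Cn_on n U f" "length is \<le> n" "x \<in> U"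
  shows "partials is (\<lambda>x. h (f x)) x = h (partials is f x)"
  using assms(4,5)
proof (induction "is" arbitrary: x)
  case (Cons i "is")
  have "Cn_on (length is + 1) U f" by (rule Cn_on_mono[OF assms(3)]) (use Cons in auto)
  then have C: "Cn_on (Suc 0) U (partials is f)" using Cn_on_partials[of "is" 1] by simp
  have "partial i (partials is (\<lambda>x. h (f x))) x = partial i (\<lambda>x. h (partials is f x)) x"
    by (rule partial_cong_open[OF assms(1)]) (use Cons in auto)
  also have "\<dots> = h (partial i (partials is f) x)"
    by (rule has_partialD(2), rule has_partial_bounded_linear[OF assms(2)
          Cn_on_has_partial[OF C]]) (use Cons in auto)
  finally show ?case by simp
qed simp

lemma partials_add:
  assumes "open U" "Cn_on n U f" "Cn_on n U g" "length is \<le> n" "x \<in> U"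
  shows "partials is (\<lambda>x. f x + g x) x = partials is f x + partials is g x"
  using assms(4,5)
proof (induction "is" arbitrary: x)
  case (Cons i "is")
  have C: "Cn_on (Suc 0) U (partials is h)" if "Cn_on n U h" for h :: "real^'a \<Rightarrow> 'b"
    using Cn_on_partials[of "is" 1 U h] Cn_on_mono[OF that, of "length is + 1"] Cons.prems by simp
  have "partial i (partials is (\<lambda>x. f x + g x)) x = partial i (\<lambda>x. partials is f x + partials is g x) x"
    by (rule partial_cong_open[OF assms(1)]) (use Cons in auto)
  also have "\<dots> = partial i (partials is f) x + partial i (partials is g) x"
    by (rule has_partialD(2), intro has_partial_add Cn_on_has_partial[OF C] assms)
       (use Cons in auto)
  finally show ?case by simp
qed simp

section \<open>Symmetry of iterated partial derivatives\<close>

lemma mvt_along_axis: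
  fixes f :: "real^'d::finite \<Rightarrow> real"
  assumes "h > 0" "\<And>t. 0 \<le> t \<Longrightarrow> t \<le> h \<Longrightarrow> partial_differentiable i f (x + t *\<^sub>R axis i 1)"
  shows "\<exists>t. 0 < t \<and> t < h \<and> f (x + h *\<^sub>R axis i 1) - f x = h * partial i f (x + t *\<^sub>R axis i 1)"
proof -
  have "\<exists>z. 0 < z \<and> z < h \<and> (\<lambda>t. f (x + t *\<^sub>R axis i 1)) h - (\<lambda>t. f (x + t *\<^sub>R axis i 1)) 0
      = (h - 0) * partial i f (x + z *\<^sub>R axis i 1)"
    by (rule MVT2) (use assms has_vector_derivative_along_axis[of i f x] in
        \<open>auto simp: has_real_derivative_iff_has_vector_derivative\<close>)
  then show ?thesis by simp
qed

text \<open>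
  The second mixed difference is an increment, in direction \<open>i\<close>, of the increment of \<open>f\<close> in
  direction \<open>j\<close>. Two applications of the mean value theorem turn it into a value of a mixed
  second derivative. The left-hand side is symmetric in \<open>i\<close> and \<open>j\<close>, the right-hand side is not
  visibly so, and this yields the symmetry of second derivatives.
\<close>

lemma mixed_difference_mvt:
  fixes f :: "real^'d::finite \<Rightarrow> real"
  assumes C: "Cn_on 2 U f" and h: "h > 0" and U: "cball x (2 * h) \<subseteq> U"
  shows "\<exists>y. dist x y \<le> 2 * h \<and>
    f (x + h *\<^sub>R axis i 1 + h *\<^sub>R axis j 1) - f (x + h *\<^sub>R axis i 1) - f (x + h *\<^sub>R axis j 1) + f x
      = h * (h * partial j (partial i f) y)"
proof -
  have in_cball: "dist x (x + s *\<^sub>R axis i 1 + t *\<^sub>R axis j 1) \<le> 2 * h" if "0 \<le> s" "s \<le> h" "0 \<le> t" "t \<le> h" for s t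
  proof -
    have "norm (s *\<^sub>R axis i (1::real) + t *\<^sub>R axis j (1::real)) \<le> \<bar>s\<bar> + \<bar>t\<bar>"
      by (rule norm_triangle_le) simp
    moreover have "dist x (x + s *\<^sub>R axis i 1 + t *\<^sub>R axis j 1) = norm (s *\<^sub>R axis i (1::real) + t *\<^sub>R axis j (1::real))"
      by (metis add.assoc add_diff_cancel_left' dist_commute dist_norm)
    ultimately show ?thesis using that by linarith
  qed
  then have inU: "x + s *\<^sub>R axis i 1 + t *\<^sub>R axis j 1 \<in> U" if "0 \<le> s" "s \<le> h" "0 \<le> t" "t \<le> h" for s t
    using U that by auto
  have d: "\<And>y i. y \<in> U \<Longrightarrow> partial_differentiable i f y"
    and d2: "\<And>y i j. y \<in> U \<Longrightarrow> partial_differentiable j (partial i f) y"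
    using C by (auto simp: numeral_2_eq_2)
  define g where "g z = f (z + h *\<^sub>R axis j 1) - f z" for z
  have g: "has_partial i g (partial i f (z + h *\<^sub>R axis j 1) - partial i f z) z"
    if "z + h *\<^sub>R axis j 1 \<in> U" "z \<in> U" for z
    using has_vector_derivative_diff[OF has_partial_partial[OF d[OF that(1)], unfolded has_partial_def]
        has_partial_partial[OF d[OF that(2)], unfolded has_partial_def]]
    unfolding g_def has_partial_def by (simp add: add_ac)
  obtain s where s: "0 < s" "s < h"
    "g (x + h *\<^sub>R axis i 1) - g x = h * partial i g (x + s *\<^sub>R axis i 1)"
  proof -
    have "partial_differentiable i g (x + t *\<^sub>R axis i 1)" if "0 \<le> t" "t \<le> h" for t
      using that inU[of t h] inU[of t 0] h by (intro has_partialD(1)[OF g]) auto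
    then show ?thesis using mvt_along_axis[OF h, of i g x] that by blast
  qed
  have "partial i g (x + s *\<^sub>R axis i 1)
      = partial i f (x + s *\<^sub>R axis i 1 + h *\<^sub>R axis j 1) - partial i f (x + s *\<^sub>R axis i 1)"
    using s inU[of s h] inU[of s 0] by (intro has_partialD(2) g) auto
  moreover obtain t where t: "0 < t" "t < h"
    "partial i f (x + s *\<^sub>R axis i 1 + h *\<^sub>R axis j 1) - partial i f (x + s *\<^sub>R axis i 1)
      = h * partial j (partial i f) (x + s *\<^sub>R axis i 1 + t *\<^sub>R axis j 1)"
  proof -
    have "partial_differentiable j (partial i f) (x + s *\<^sub>R axis i 1 + t *\<^sub>R axis j 1)"
      if "0 \<le> t" "t \<le> h" for t
      using that inU[of s t] s by (intro d2) auto
    then show ?thesis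
      using mvt_along_axis[OF h, of j "partial i f" "x + s *\<^sub>R axis i 1"] that by blast
  qed
  ultimately show ?thesis using s t in_cball[of s t]
    by (intro exI[of _ "x + s *\<^sub>R axis i 1 + t *\<^sub>R axis j 1"]) (auto simp: g_def algebra_simps)
qed

text \<open>
  Schwarz's theorem. If the two mixed derivatives at \<open>x\<close> differed by \<open>2 * e\<close>, then close to \<open>x\<close>
  each would stay within \<open>e\<close> of its value at \<open>x\<close>, yet both attain there the same number, namely the
  mixed difference divided by \<open>h\<^sup>2\<close>.
\<close>

lemma partial_commute_real:
  fixes f :: "real^'d::finite \<Rightarrow> real"
  assumes U: "open U" and C: "Cn_on 2 U f" and x: "x \<in> U"
  shows "partial i (partial j f) x = partial j (partial i f) x"
proof (rule ccontr)
  assume ne: "partial i (partial j f) x \<noteq> partial j (partial i f) x"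
  define e where "e = dist (partial i (partial j f) x) (partial j (partial i f) x) / 2"
  have e: "e > 0" using ne by (simp add: e_def)
  have near: "\<exists>\<delta>>0. \<forall>y. dist x y < \<delta> \<longrightarrow> dist (partial k (partial l f) y) (partial k (partial l f) x) < e" for k l
  proof -
    have "continuous_on U (partial k (partial l f))" using C by (simp add: numeral_2_eq_2)
    then have "isCont (partial k (partial l f)) x" using U x continuous_on_eq_continuous_at by blast
    then show ?thesis using e unfolding continuous_at_eps_delta dist_commute[of x] by blast
  qed
  obtain \<delta>1 where 1: "\<delta>1 > 0" "\<And>y. dist x y < \<delta>1 \<Longrightarrow> dist (partial i (partial j f) y) (partial i (partial j f) x) < e"
    using near by blast
  obtain \<delta>2 where 2: "\<delta>2 > 0" "\<And>y. dist x y < \<delta>2 \<Longrightarrow> dist (partial j (partial i f) y) (partial j (partial i f) x) < e"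
    using near by blast
  obtain r where r: "r > 0" "cball x r \<subseteq> U" using U x open_contains_cball by blast
  define h where "h = min r (min \<delta>1 \<delta>2) / 4"
  have h: "h > 0" "2 * h \<le> r" "2 * h < \<delta>1" "2 * h < \<delta>2" using 1(1) 2(1) r(1) by (auto simp: h_def min_def)
  have sub: "cball x (2 * h) \<subseteq> U" using h r by auto
  obtain y where y: "dist x y \<le> 2 * h" 
    "f (x + h *\<^sub>R axis i 1 + h *\<^sub>R axis j 1) - f (x + h *\<^sub>R axis i 1) - f (x + h *\<^sub>R axis j 1) + f x
      = h * (h * partial j (partial i f) y)"
    using mixed_difference_mvt[OF C h(1) sub] by blast
  obtain z where z: "dist x z \<le> 2 * h" 
    "f (x + h *\<^sub>R axis j 1 + h *\<^sub>R axis i 1) - f (x + h *\<^sub>R axis j 1) - f (x + h *\<^sub>R axis i 1) + f x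
      = h * (h * partial i (partial j f) z)"
    using mixed_difference_mvt[OF C h(1) sub] by blast
  have "h * (h * partial j (partial i f) y) = h * (h * partial i (partial j f) z)"
    using y(2) z(2) by (simp add: algebra_simps)
  then have "partial j (partial i f) y = partial i (partial j f) z" using h(1) by simp
  moreover have "dist (partial j (partial i f) y) (partial j (partial i f) x) < e" using 2(2) y(1) h by auto
  moreover have "dist (partial i (partial j f) z) (partial i (partial j f) x) < e" using 1(2) z(1) h by auto
  moreover have "dist (partial i (partial j f) x) (partial j (partial i f) x)
      \<le> dist (partial i (partial j f) z) (partial i (partial j f) x)
        + dist (partial i (partial j f) z) (partial j (partial i f) x)"
    by (rule dist_triangle3)
  ultimately show False by (simp add: e_def)
qed

lemma partial_commute:
  fixes f :: "real^'d::finite \<Rightarrow> 'k::euclidean_space"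
  assumes "open U" "Cn_on 2 U f" "x \<in> U"
  shows "partial i (partial j f) x = partial j (partial i f) x"
proof (rule euclidean_eqI)
  fix b :: 'k assume "b \<in> Basis"
  have "partials [k, l] (\<lambda>x. f x \<bullet> b) x = partials [k, l] f x \<bullet> b" for k l
    by (rule partials_bounded_linear[OF assms(1) bounded_linear_inner_left assms(2)]) (use assms in auto)
  moreover have "partial i (partial j (\<lambda>x. f x \<bullet> b)) x = partial j (partial i (\<lambda>x. f x \<bullet> b)) x"
    by (rule partial_commute_real[OF assms(1) Cn_on_bounded_linear[OF assms(1)
          bounded_linear_inner_left assms(2)] assms(3)])
  ultimately show "partial i (partial j f) x \<bullet> b = partial j (partial i f) x \<bullet> b" by simp
qed

lemma partials_move_to_front:
  fixes f :: "real^'d::finite \<Rightarrow> 'k::euclidean_space"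
  assumes "open U" "Cn_on n U f" "length as + length bs < n" "x \<in> U"
  shows "partials (as @ i # bs) f x = partials (i # as @ bs) f x"
  using assms(3,4)
proof (induction as arbitrary: x)
  case (Cons a as)
  have "Cn_on (length (as @ bs) + 2) U f" by (rule Cn_on_mono[OF assms(2)]) (use Cons in auto)
  then have C: "Cn_on 2 U (partials (as @ bs) f)" by (rule Cn_on_partials)
  have "partials ((a # as) @ i # bs) f x = partial a (partial i (partials (as @ bs) f)) x"
    using partial_cong_open[OF assms(1) Cons.prems(2), of "partials (as @ i # bs) f" "partials (i # as @ bs) f" a]
      Cons.IH Cons.prems(1) by simp
  also have "\<dots> = partial i (partial a (partials (as @ bs) f)) x"
    by (rule partial_commute[OF assms(1) C Cons.prems(2)])
  finally show ?case by simp
qed simp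

text \<open>
  A permutation is undone by moving one entry after the other to the front, and each such move is a
  chain of exchanges of neighbours.
\<close>

lemma partials_mset_eq:
  fixes f :: "real^'d::finite \<Rightarrow> 'k::euclidean_space"
  assumes "open U" "Cn_on n U f" "length is \<le> n" "mset is = mset js" "x \<in> U"
  shows "partials is f x = partials js f x"
  using assms(3-5)
proof (induction "is" arbitrary: js x)
  case (Cons i "is")
  have "i \<in> set js" using mset_eq_setD[OF Cons.prems(2)] by auto
  then obtain as bs where js: "js = as @ i # bs" by (meson split_list)
  have m: "mset is = mset (as @ bs)" using Cons.prems(2) js by simp
  have "length is = length (as @ bs)" using m by (rule mset_eq_length)
  then have "partials js f x = partials (i # as @ bs) f x"
    unfolding js using Cons.prems(1,3) by (intro partials_move_to_front[OF assms(1,2)]) simp_all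
  moreover have "partial i (partials is f) x = partial i (partials (as @ bs) f) x"
  proof (rule partial_cong_open[OF assms(1) Cons.prems(3)])
    show "partials is f y = partials (as @ bs) f y" if "y \<in> U" for y
      by (rule Cons.IH[OF _ m that]) (use Cons.prems(1) in simp)
  qed
  ultimately show ?case by simp
qed simp

lemma exists_list_of_multiindex:
  fixes j :: "'d::finite \<Rightarrow> nat"
  shows "\<exists>is. count_list is = j"
proof -
  have "count (Abs_multiset j) = j" by (rule count_Abs_multiset) simp
  moreover obtain "is" where "mset is = Abs_multiset j" using ex_mset by blast
  ultimately have "count_list is = j" using count_mset[of "is"] by (simp add: fun_eq_iff)
  then show ?thesis ..
qed

lemma length_eq_mi_abs: "length is = mi_abs (count_list is)"
proof -
  have "sum (count_list is) (set is) = mi_abs (count_list is)"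
    unfolding mi_abs_def by (rule sum.mono_neutral_left) (auto simp: count_list_0_iff)
  then show ?thesis by (simp add: sum_count_set)
qed

lemma mi_partial_as_partials:
  fixes j :: "'d::finite \<Rightarrow> nat"
  obtains "is" where "length is = mi_abs j" "count_list is = j"
    "\<And>f :: real^'d \<Rightarrow> 'k::real_normed_vector. mi_partial j f = partials is f"
proof
  let ?js = "SOME is. \<forall>i. count_list is i = j i"
  have "\<exists>is. \<forall>i. count_list is i = j i" using exists_list_of_multiindex[of j] by auto
  then have "\<forall>i. count_list ?js i = j i" by (rule someI_ex)
  then show c: "count_list ?js = j" by auto
  show "length ?js = mi_abs j" using length_eq_mi_abs[of ?js] c by simp
qed (simp add: mi_partial_def)

text \<open>
  This makes the derivative for a multi-index independent of the list of directions chosen in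
  its definition.
\<close>

lemma mi_partial_eq_partials:
  fixes f :: "real^'d::finite \<Rightarrow> 'k::euclidean_space"
  assumes "open U" "Cn_on n U f" "length is \<le> n" "x \<in> U"
  shows "mi_partial (count_list is) f x = partials is f x"
proof -
  obtain js where js: "length js = mi_abs (count_list is)" "count_list js = count_list is"
    "\<And>f :: real^'d \<Rightarrow> 'k. mi_partial (count_list is) f = partials js f"
    by (rule mi_partial_as_partials[where ?'d = 'd and ?'k = 'k and j = "count_list is"]) (rule that)
  have "mset is = mset js" by (intro multiset_eqI) (simp add: count_mset js(2))
  then show ?thesis unfolding js(3)
    by (rule partials_mset_eq[OF assms(1-3) _ assms(4), symmetric])
qed

section \<open>Functions vanishing to a given order at a point\<close>

text \<open>
  For a function of class \<open>C\<^sup>n\<close>, vanishing to order \<open>n\<close> is the same as \<open>f x = o(|x - x0|\<^sup>n)\<close>. The derivatives are taken along lists of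
  directions rather than for multi-indices, so that an induction can peel off the direction
  differentiated first and apply the hypothesis to \<open>partial i f\<close>.
\<close>

definition vanishes_to_order ::
    "nat \<Rightarrow> (real^'d) set \<Rightarrow> real^'d \<Rightarrow> (real^'d::finite \<Rightarrow> 'k::real_normed_vector) \<Rightarrow> bool"
  where "vanishes_to_order n U x0 f \<longleftrightarrow>
    Cn_on n U f \<and> (\<forall>is. length is \<le> n \<longrightarrow> partials is f x0 = 0)"

lemma vanishes_to_order_Suc:
  "vanishes_to_order (Suc n) U x0 f \<longleftrightarrow>
    Cn_on (Suc n) U f \<and> f x0 = 0 \<and> (\<forall>i. vanishes_to_order n U x0 (partial i f))"
proof
  assume "vanishes_to_order (Suc n) U x0 f"
  then have C: "Cn_on (Suc n) U f" and *: "\<And>is. length is \<le> Suc n \<Longrightarrow> partials is f x0 = 0"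
    by (auto simp: vanishes_to_order_def)
  have "partials is (partial i f) x0 = 0" if "length is \<le> n" for "is" i
    using *[of "is @ [i]"] that by simp
  moreover have "Cn_on n U (partial i f)" for i using C by simp
  ultimately show "Cn_on (Suc n) U f \<and> f x0 = 0 \<and> (\<forall>i. vanishes_to_order n U x0 (partial i f))"
    using C *[of "[]"] by (simp add: vanishes_to_order_def)
next
  assume *: "Cn_on (Suc n) U f \<and> f x0 = 0 \<and> (\<forall>i. vanishes_to_order n U x0 (partial i f))"
  have "partials is f x0 = 0" if "length is \<le> Suc n" for "is"
    using that * by (cases "is" rule: rev_cases) (auto simp: vanishes_to_order_def)
  then show "vanishes_to_order (Suc n) U x0 f" using * by (simp add: vanishes_to_order_def)
qed

lemma vanishes_to_order_mono:
  "vanishes_to_order n U x0 f \<Longrightarrow> m \<le> n \<Longrightarrow> vanishes_to_order m U x0 f"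
  unfolding vanishes_to_order_def using Cn_on_mono[of n U f m] by simp

lemma vanishes_to_order_partials:
  assumes "vanishes_to_order (length is + n) U x0 f"
  shows "vanishes_to_order n U x0 (partials is f)"
  unfolding vanishes_to_order_def
proof (intro conjI allI impI)
  show "Cn_on n U (partials is f)" using assms by (auto simp: vanishes_to_order_def intro: Cn_on_partials)
  fix js :: "'a list" assume "length js \<le> n"
  then show "partials js (partials is f) x0 = 0"
    using assms[unfolded vanishes_to_order_def, THEN conjunct2, rule_format, of "js @ is"] by simp
qed

lemma vanishes_to_order_cong_open:
  assumes "open U" "x0 \<in> U" "vanishes_to_order n U x0 f" "\<And>y. y \<in> U \<Longrightarrow> f y = g y"
  shows "vanishes_to_order n U x0 g"
proof -
  have "Cn_on n U g"
    by (rule Cn_on_cong_open[OF assms(1) _ assms(4)]) (use assms(3) in \<open>simp_all add: vanishes_to_order_def\<close>)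
  moreover have "partials is f x0 = partials is g x0" for "is"
    by (rule partials_cong_open[OF assms(1,4,2)])
  ultimately show ?thesis using assms(3) by (simp add: vanishes_to_order_def)
qed

lemma vanishes_to_order_zero:
  "vanishes_to_order n U (x0 :: real^'d::finite) (\<lambda>x. 0 :: 'k::real_normed_vector)"
proof -
  have "partial i (\<lambda>x. 0) = (\<lambda>x :: real^'d. 0 :: 'k)" for i
    by (rule ext) (rule has_partialD(2)[OF has_partial_const])
  then have "partials is (\<lambda>x. 0) = (\<lambda>x :: real^'d. 0 :: 'k)" for "is"
    by (induction "is") auto
  then show ?thesis by (simp add: vanishes_to_order_def Cn_on_const)
qed

lemma vanishes_to_order_add:
  assumes "open U" "x0 \<in> U" "vanishes_to_order n U x0 f" "vanishes_to_order n U x0 g"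
  shows "vanishes_to_order n U x0 (\<lambda>x. f x + g x)"
proof -
  have C: "Cn_on n U f" "Cn_on n U g" using assms(3,4) by (simp_all add: vanishes_to_order_def)
  have "partials is (\<lambda>x. f x + g x) x0 = 0" if "length is \<le> n" for "is"
    using partials_add[OF assms(1) C that assms(2)] assms(3,4) that
    by (simp add: vanishes_to_order_def)
  then show ?thesis using Cn_on_add[OF assms(1) C] by (simp add: vanishes_to_order_def)
qed

lemma vanishes_to_order_sum:
  assumes "open U" "x0 \<in> U" "\<And>j. j \<in> A \<Longrightarrow> vanishes_to_order n U x0 (f j)"
  shows "vanishes_to_order n U x0 (\<lambda>x. \<Sum>j\<in>A. f j x)"
  using assms(3)
  by (induction A rule: infinite_finite_induct)
     (simp_all add: vanishes_to_order_zero vanishes_to_order_add[OF assms(1,2)])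

text \<open>
  By the product rule the derivatives of \<open>c * f\<close> up to order \<open>n\<close> are combinations of the derivatives
  of \<open>f\<close> up to order \<open>n\<close>. In the induction, one application of the product rule leaves two products to
  which the hypothesis applies.
\<close>

lemma vanishes_to_order_mult:
  fixes f c :: "real^'d::finite \<Rightarrow> 'k::real_normed_algebra"
  assumes U: "open U" "x0 \<in> U" and "Cn_on n U c" "vanishes_to_order n U x0 f"
  shows "vanishes_to_order n U x0 (\<lambda>x. c x * f x)"
  using assms(3,4)
proof (induction n arbitrary: c f)
  case 0
  then show ?case using Cn_on_mult[OF U(1), of 0 c f] by (simp add: vanishes_to_order_def)
next
  case (Suc n)
  have f: "Cn_on (Suc n) U f" "f x0 = 0" "\<And>i. vanishes_to_order n U x0 (partial i f)"
    using Suc.prems(2) by (simp_all only: vanishes_to_order_Suc)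
  have f': "vanishes_to_order n U x0 f" by (rule vanishes_to_order_mono[OF Suc.prems(2)]) simp
  have "vanishes_to_order n U x0 (partial i (\<lambda>x. c x * f x))" for i
  proof (rule vanishes_to_order_cong_open[OF U])
    show "vanishes_to_order n U x0 (\<lambda>x. c x * partial i f x + partial i c x * f x)"
      using Suc.prems(1) f(3) f'
      by (intro vanishes_to_order_add[OF U] Suc.IH Cn_on_Suc_imp[OF Suc.prems(1)]) auto
    show "c y * partial i f y + partial i c y * f y = partial i (\<lambda>x. c x * f x) y" if "y \<in> U" for y
      using that by (intro has_partialD(2)[symmetric] has_partial_mult
          Cn_on_has_partial[OF Suc.prems(1)] Cn_on_has_partial[OF f(1)])
  qed
  then show ?case
    unfolding vanishes_to_order_Suc using Cn_on_mult[OF U(1) Suc.prems(1) f(1)] f(2) by simp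
qed

section \<open>Growth near a zero of given order\<close>

lemma increment_along_axis_le:
  fixes f :: "real^'d::finite \<Rightarrow> 'k::real_normed_vector"
  assumes "\<And>t. \<bar>t\<bar> \<le> \<bar>a\<bar> \<Longrightarrow> partial_differentiable i f (x + t *\<^sub>R axis i 1)"
    and "\<And>t. \<bar>t\<bar> \<le> \<bar>a\<bar> \<Longrightarrow> norm (partial i f (x + t *\<^sub>R axis i 1)) \<le> B"
  shows "norm (f (x + a *\<^sub>R axis i 1) - f x) \<le> B * \<bar>a\<bar>"
proof -
  have seg: "\<bar>t\<bar> \<le> \<bar>a\<bar>" if "t \<in> closed_segment 0 a" for t
    using that by (auto simp: closed_segment_eq_real_ivl split: if_splits)
  have "norm (f (x + a *\<^sub>R axis i 1) - f (x + 0 *\<^sub>R axis i 1)) \<le> B * norm (a - 0)"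
  proof (rule differentiable_bound[of "closed_segment 0 a" "\<lambda>t. f (x + t *\<^sub>R axis i 1)"
        "\<lambda>t s. s *\<^sub>R partial i f (x + t *\<^sub>R axis i 1)"])
    fix t assume t: "t \<in> closed_segment 0 a"
    show "((\<lambda>t. f (x + t *\<^sub>R axis i 1)) has_derivative (\<lambda>s. s *\<^sub>R partial i f (x + t *\<^sub>R axis i 1)))
        (at t within closed_segment 0 a)"
      using has_vector_derivative_along_axis[OF assms(1)[OF seg[OF t]]]
      by (metis has_vector_derivative_def has_derivative_at_withinI)
    show "onorm (\<lambda>s. s *\<^sub>R partial i f (x + t *\<^sub>R axis i 1)) \<le> B"
    proof (rule onorm_le)
      show "norm (s *\<^sub>R partial i f (x + t *\<^sub>R axis i 1)) \<le> B * norm s" for s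
        using mult_left_mono[OF assms(2)[OF seg[OF t]], of "\<bar>s\<bar>"] by (simp add: mult.commute)
    qed
  qed auto
  then show ?thesis by simp
qed

text \<open>
  The point \<open>x\<close> is reached from \<open>x0\<close> by switching on the coordinates of \<open>x - x0\<close> one at a time. All
  points on this path are at most as far from \<open>x0\<close> as \<open>x\<close> is, and each of its \<open>CARD('d)\<close> legs is
  parallel to an axis, so the mean value inequality in one variable bounds the increment along it.
\<close>

lemma norm_le_of_partials_le:
  fixes f :: "real^'d::finite \<Rightarrow> 'k::real_normed_vector" and B :: real
  assumes diff: "\<And>i y. norm (y - x0) \<le> norm (x - x0) \<Longrightarrow> partial_differentiable i f y"
    and bound: "\<And>i y. norm (y - x0) \<le> norm (x - x0) \<Longrightarrow> norm (partial i f y) \<le> B"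
    and zero: "f x0 = 0"
  shows "norm (f x) \<le> CARD('d) * B * norm (x - x0)"
proof -
  define h where "h = x - x0"
  define hS where "hS S = (\<chi> k. if k \<in> S then h $ k else 0)" for S
  have "norm (partial undefined f x0) \<le> B" by (rule bound) simp
  then have B: "B \<ge> 0" using norm_ge_zero order_trans by blast
  have "norm (f (x0 + hS S)) \<le> card S * B * norm h" if "finite S" for S
    using that
  proof induction
    case empty
    have "hS {} = 0" by (simp add: hS_def vec_eq_iff)
    then show ?case using zero by simp
  next
    case (insert i S)
    have step: "hS (insert i S) = hS S + (h $ i) *\<^sub>R axis i 1"
      using insert.hyps by (auto simp: hS_def vec_eq_iff axis_def)
    have inside: "norm (x0 + hS S + t *\<^sub>R axis i 1 - x0) \<le> norm (x - x0)" if "\<bar>t\<bar> \<le> \<bar>h $ i\<bar>" for t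
      unfolding h_def[symmetric] using insert.hyps that
      by (intro norm_le_componentwise_cart) (auto simp: hS_def axis_def)
    have "norm (f (x0 + hS S + (h $ i) *\<^sub>R axis i 1) - f (x0 + hS S)) \<le> B * \<bar>h $ i\<bar>"
      by (intro increment_along_axis_le diff bound inside)
    also have "\<dots> \<le> B * norm h" using B component_le_norm_cart[of h i] by (intro mult_left_mono)
    finally have "norm (f (x0 + hS (insert i S)) - f (x0 + hS S)) \<le> B * norm h"
      by (simp add: step add.assoc)
    then have "norm (f (x0 + hS (insert i S))) \<le> norm (f (x0 + hS S)) + B * norm h"
      using norm_triangle_sub[of "f (x0 + hS (insert i S))" "f (x0 + hS S)"] by linarith
    then show ?case using insert by (simp add: algebra_simps)
  qed
  from this[of UNIV] have "norm (f (x0 + hS UNIV)) \<le> CARD('d) * B * norm h" by simp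
  moreover have "x0 + hS UNIV = x" by (simp add: hS_def h_def vec_eq_iff)
  ultimately show ?thesis by (simp add: h_def)
qed

text \<open>
  The remainder estimate in Taylor's theorem. In the step to \<open>Suc n\<close> the partial derivatives are
  \<open>O(|x - x0|\<^sup>n)\<close> by induction, and following a path from \<open>x0\<close> to \<open>x\<close> gains one power. For \<open>n = 0\<close>
  the claim is local boundedness of a continuous function; this is what the derivatives of the highest
  order contribute.
\<close>

lemma eventually_norm_le_power:
  fixes f :: "real^'d::finite \<Rightarrow> 'k::real_normed_vector"
  assumes "open U" "x0 \<in> U" "Cn_on n U f" "\<And>is. length is < n \<Longrightarrow> partials is f x0 = 0"
  shows "\<exists>C. \<forall>\<^sub>F x in nhds x0. norm (f x) \<le> C * norm (x - x0) ^ n"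
  using assms(3,4)
proof (induction n arbitrary: f)
  case 0
  then have "(f \<longlongrightarrow> f x0) (nhds x0)"
    using assms(1,2) continuous_on_eq_continuous_at[of U f]
    by (simp add: isCont_def tendsto_at_iff_tendsto_nhds)
  then have "\<forall>\<^sub>F x in nhds x0. dist (f x) (f x0) < 1" by (rule tendstoD) simp
  then have "\<forall>\<^sub>F x in nhds x0. norm (f x) \<le> (norm (f x0) + 1) * norm (x - x0) ^ 0"
  proof eventually_elim
    case (elim x)
    then show ?case using norm_triangle_sub[of "f x" "f x0"] by (simp add: dist_norm)
  qed
  then show ?case by blast
next
  case (Suc n)
  have "\<exists>C. \<forall>\<^sub>F x in nhds x0. norm (partial i f x) \<le> C * norm (x - x0) ^ n" for i
  proof (rule Suc.IH)
    show "Cn_on n U (partial i f)" using Suc.prems(1) by simp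
    show "partials is (partial i f) x0 = 0" if "length is < n" for "is"
      using Suc.prems(2)[of "is @ [i]"] that by simp
  qed
  then obtain C where C: "\<And>i. \<forall>\<^sub>F x in nhds x0. norm (partial i f x) \<le> C i * norm (x - x0) ^ n"
    by metis
  \<comment> \<open>One constant for all directions.\<close>
  define M where "M = Max (range C)"
  have M: "C i \<le> M" for i unfolding M_def by (rule Max_ge) auto
  have "\<forall>\<^sub>F x in nhds x0. x \<in> U \<and> (\<forall>i. norm (partial i f x) \<le> M * norm (x - x0) ^ n)"
  proof (intro eventually_conj eventually_nhds_in_open assms eventually_all_finite)
    fix i
    show "\<forall>\<^sub>F x in nhds x0. norm (partial i f x) \<le> M * norm (x - x0) ^ n"
      using C[of i] by eventually_elim (use M[of i] in \<open>meson mult_right_mono norm_ge_zero order_trans zero_le_power\<close>)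
  qed
  then obtain r where r: "r > 0" "\<And>x. dist x x0 < r \<Longrightarrow> x \<in> U"
      "\<And>x i. dist x x0 < r \<Longrightarrow> norm (partial i f x) \<le> M * norm (x - x0) ^ n"
    unfolding eventually_nhds_metric by blast
  \<comment> \<open>The bound on a norm at some point other than \<open>x0\<close> forces \<open>M\<close> to be nonnegative.\<close>
  obtain z where "dist z x0 < r" "z \<noteq> x0" 
  proof
    show "dist (x0 + (r / 2) *\<^sub>R axis undefined 1) x0 < r" using r(1) by (simp add: dist_norm)
    show "x0 + (r / 2) *\<^sub>R axis undefined 1 \<noteq> x0" using r(1) by simp
  qed
  then have "0 \<le> M * norm (z - x0) ^ n" using r(3) norm_ge_zero order_trans by blast
  then have M0: "M \<ge> 0" using \<open>z \<noteq> x0\<close> by (simp add: zero_le_mult_iff power_le_zero_eq)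
  have "norm (f x) \<le> (CARD('d) * M) * norm (x - x0) ^ Suc n" if x: "dist x x0 < r" for x
  proof -
    have near: "dist y x0 < r" if "norm (y - x0) \<le> norm (x - x0)" for y
      using that x by (simp add: dist_norm)
    have "norm (f x) \<le> CARD('d) * (M * norm (x - x0) ^ n) * norm (x - x0)"
    proof (rule norm_le_of_partials_le)
      fix i y assume y: "norm (y - x0) \<le> norm (x - x0)"
      show "partial_differentiable i f y" using Suc.prems(1) r(2)[OF near[OF y]] by simp
      have "norm (y - x0) ^ n \<le> norm (x - x0) ^ n" using y by (intro power_mono) auto
      then show "norm (partial i f y) \<le> M * norm (x - x0) ^ n"
        using r(3)[OF near[OF y], of i] M0 by (meson mult_left_mono order_trans)
    qed (use Suc.prems(2)[of "[]"] in simp)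
    then show ?thesis by (simp add: mult_ac)
  qed
  then show ?case using r(1) unfolding eventually_nhds_metric by blast
qed

section \<open>Derivatives of Taylor sums\<close>

text \<open>
  With the factorial included, differentiating such a monomial merely lowers one exponent, without
  a numerical factor.
\<close>

definition scaled_monomial :: "real^'d \<Rightarrow> ('d::finite \<Rightarrow> nat) \<Rightarrow> real^'d \<Rightarrow> real"
  where "scaled_monomial x0 j x = mi_pow (x - x0) j / mi_fact j"

definition taylor_sum ::
    "nat \<Rightarrow> (('d \<Rightarrow> nat) \<Rightarrow> 'k) \<Rightarrow> real^'d \<Rightarrow> real^'d::finite \<Rightarrow> 'k::real_normed_vector"
  where "taylor_sum n a x0 x = (\<Sum>j | mi_abs j \<le> n. scaled_monomial x0 j x *\<^sub>R a j)"

lemma mi_abs_upd_Suc: "mi_abs (j(i := Suc (j i))) = Suc (mi_abs j)"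
proof -
  have "mi_abs (j(i := Suc (j i))) = Suc (j i) + (\<Sum>k\<in>UNIV - {i}. j k)"
    unfolding mi_abs_def by (subst sum.remove[of UNIV i]) auto
  also have "\<dots> = Suc (mi_abs j)"
    using sum.remove[of UNIV i j] by (simp add: mi_abs_def)
  finally show ?thesis .
qed

lemma mi_abs_upd_pred:
  assumes "j i \<noteq> 0"
  shows "Suc (mi_abs (j(i := j i - Suc 0))) = mi_abs j"
  using mi_abs_upd_Suc[of "j(i := j i - 1)" i] assms by simp

lemma has_partial_scaled_monomial:
  "has_partial i (scaled_monomial x0 j)
     (if j i = 0 then 0 else scaled_monomial x0 (j(i := j i - 1)) x) x"
proof -
  define R where "R = (\<Prod>k\<in>UNIV - {i}. (x $ k - x0 $ k) ^ j k / fact (j k))"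
  have split: "scaled_monomial x0 j' y = (y $ i - x0 $ i) ^ j' i / fact (j' i) * R"
    if "\<And>k. k \<noteq> i \<Longrightarrow> j' k = j k \<and> y $ k = x $ k" for j' y
  proof -
    have "scaled_monomial x0 j' y = (\<Prod>k\<in>UNIV. (y $ k - x0 $ k) ^ j' k / fact (j' k))"
      by (simp add: scaled_monomial_def mi_pow_def mi_fact_def prod_dividef)
    also have "\<dots> = (y $ i - x0 $ i) ^ j' i / fact (j' i) * R"
      unfolding R_def by (subst prod.remove[of UNIV i]) (use that in \<open>auto intro!: prod.cong\<close>)
    finally show ?thesis .
  qed
  define d where "d = real (j i) * (x $ i - x0 $ i) ^ (j i - 1) / fact (j i) * R"
  have "scaled_monomial x0 j (x + t *\<^sub>R axis i 1) = (x $ i + t - x0 $ i) ^ j i / fact (j i) * R" for t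
    by (subst split) (auto simp: axis_def)
  moreover have "((\<lambda>t. (x $ i + t - x0 $ i) ^ j i / fact (j i) * R) has_real_derivative d) (at 0)"
    unfolding d_def by (auto intro!: derivative_eq_intros)
  ultimately have "has_partial i (scaled_monomial x0 j) d x"
    unfolding has_partial_def by (simp add: has_real_derivative_iff_has_vector_derivative)
  moreover have "d = (if j i = 0 then 0 else scaled_monomial x0 (j(i := j i - 1)) x)"
  proof (cases "j i")
    case (Suc m)
    have "scaled_monomial x0 (j(i := j i - 1)) x = (x $ i - x0 $ i) ^ m / fact m * R"
      by (subst split) (auto simp: Suc)
    moreover have "d = (x $ i - x0 $ i) ^ m / fact m * R"
      by (simp add: d_def Suc del: of_nat_Suc)
    ultimately show ?thesis by (simp add: Suc)
  qed (simp add: d_def)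
  ultimately show ?thesis by simp
qed

lemma has_partial_sum:
  assumes "\<And>j. j \<in> A \<Longrightarrow> has_partial i (f j) (f' j) x"
  shows "has_partial i (\<lambda>x. \<Sum>j\<in>A. f j x) (\<Sum>j\<in>A. f' j) x"
  using assms unfolding has_partial_def by (rule has_vector_derivative_sum)

text \<open>
  Differentiation shifts the coefficients. Since the coefficients beyond \<open>n\<close> are zero, the shifted
  family has the same property and the bound \<open>n\<close> can stay the same, which lets the rule be iterated.
\<close>

lemma has_partial_taylor_sum:
  assumes "\<And>j. n < mi_abs j \<Longrightarrow> a j = 0"
  shows "has_partial i (taylor_sum n a x0) (taylor_sum n (\<lambda>j. a (j(i := Suc (j i)))) x0 x) x"
proof -
  let ?m = "\<lambda>j. scaled_monomial x0 j x"
  have "has_partial i (taylor_sum n a x0)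
     (\<Sum>j | mi_abs j \<le> n. (if j i = 0 then 0 else ?m (j(i := j i - 1))) *\<^sub>R a j) x"
    unfolding taylor_sum_def[abs_def]
    by (intro has_partial_sum has_partial_bounded_linear[OF bounded_linear_scaleR_left]
        has_partial_scaled_monomial)
  also have "(\<Sum>j | mi_abs j \<le> n. (if j i = 0 then 0 else ?m (j(i := j i - 1))) *\<^sub>R a j)
      = (\<Sum>j | mi_abs j \<le> n \<and> j i \<noteq> 0. ?m (j(i := j i - 1)) *\<^sub>R a j)"
    by (rule sum.mono_neutral_cong_right) (auto simp: finite_mi_abs_le)
  also have "\<dots> = (\<Sum>j | Suc (mi_abs j) \<le> n. ?m j *\<^sub>R a (j(i := Suc (j i))))"
    by (rule sum.reindex_bij_witness[of _ "\<lambda>j. j(i := Suc (j i))" "\<lambda>j. j(i := j i - 1)"])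
       (auto simp: mi_abs_upd_Suc mi_abs_upd_pred)
  also have "\<dots> = taylor_sum n (\<lambda>j. a (j(i := Suc (j i)))) x0 x"
    unfolding taylor_sum_def
    by (rule sum.mono_neutral_left) (auto simp: finite_mi_abs_le mi_abs_upd_Suc intro!: assms)
  finally show ?thesis .
qed

lemma partials_taylor_sum:
  assumes "\<And>j. n < mi_abs j \<Longrightarrow> a j = 0"
  shows "partials is (taylor_sum n a x0) = taylor_sum n (\<lambda>j. a (\<lambda>k. j k + count_list is k)) x0"
proof (induction "is")
  case (Cons i "is")
  have "a (\<lambda>k. j k + count_list is k) = 0" if "n < mi_abs j" for j
    using that by (intro assms) (simp add: mi_abs_def sum.distrib)
  then have "partial i (taylor_sum n (\<lambda>j. a (\<lambda>k. j k + count_list is k)) x0)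
      = taylor_sum n (\<lambda>j. a (\<lambda>k. (j(i := Suc (j i))) k + count_list is k)) x0"
    by (intro ext has_partialD(2) has_partial_taylor_sum)
  moreover have "(\<lambda>k. (j(i := Suc (j i))) k + count_list is k) = (\<lambda>k. j k + count_list (i # is) k)" for j
    by auto
  ultimately show ?case using Cons by simp
qed simp

lemma taylor_sum_at_center: "taylor_sum n a x0 x0 = a (\<lambda>_. 0)"
proof -
  have "scaled_monomial x0 j x0 *\<^sub>R a j = (if j = (\<lambda>_. 0) then a j else 0)" for j
  proof (cases "j = (\<lambda>_. 0)")
    case True
    then show ?thesis by (simp add: scaled_monomial_def mi_pow_def mi_fact_def)
  next
    case False
    then obtain k where "j k \<noteq> 0" by auto
    then have "mi_pow (x0 - x0) j = 0" unfolding mi_pow_def by (intro prod_zero) auto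
    then show ?thesis using False by (simp add: scaled_monomial_def)
  qed
  then show ?thesis by (simp add: taylor_sum_def finite_mi_abs_le) (simp add: mi_abs_def)
qed

lemma Cn_on_taylor_sum:
  assumes "open U" "\<And>j. n < mi_abs j \<Longrightarrow> a j = 0"
  shows "Cn_on m U (taylor_sum n a x0)"
  using assms(2)
proof (induction m arbitrary: a)
  case 0
  show ?case unfolding taylor_sum_def[abs_def] scaled_monomial_def mi_pow_def
    by (auto intro!: continuous_intros simp: mi_fact_def)
next
  case (Suc m)
  show ?case
  proof (rule Cn_on_SucI[OF assms(1)])
    show "continuous_on U (taylor_sum n a x0)"
      by (rule Cn_on_imp_continuous_on[OF Suc.IH[OF Suc.prems]])
    show "has_partial i (taylor_sum n a x0) (taylor_sum n (\<lambda>j. a (j(i := Suc (j i)))) x0 x) x" for i x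
      by (rule has_partial_taylor_sum[OF Suc.prems])
    show "Cn_on m U (taylor_sum n (\<lambda>j. a (j(i := Suc (j i)))) x0)" for i
    proof (rule Suc.IH)
      show "a (j(i := Suc (j i))) = 0" if "n < mi_abs j" for j
        using that by (intro Suc.prems) (simp only: mi_abs_upd_Suc)
    qed
  qed
qed

lemma sum_over_orders:
  "(\<Sum>l=0..n. \<Sum>j | mi_abs j = l. g j) = (\<Sum>j | mi_abs j \<le> n. g j)"
proof -
  have "(\<Sum>j | mi_abs j \<le> n. g j) = (\<Sum>l\<in>{0..n}. sum g {j \<in> {j. mi_abs j \<le> n}. mi_abs j = l})"
    by (rule sum.group[symmetric]) (auto simp: finite_mi_abs_le)
  also have "\<dots> = (\<Sum>l=0..n. \<Sum>j | mi_abs j = l. g j)"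
    by (intro sum.cong refl) auto
  finally show ?thesis ..
qed

lemma taylor_eq_taylor_sum:
  "taylor n x0 f = taylor_sum n (\<lambda>j. if mi_abs j \<le> n then mi_partial j f x0 else 0) x0"
  unfolding taylor_def sum_over_orders taylor_sum_def[abs_def] scaled_monomial_def
  by (intro ext sum.cong) auto

section \<open>Polynomials in powers of a translated variable\<close>

lemma polysI: "(\<And>x. f x = (\<Sum>j | mi_abs j \<le> n. mi_pow x j *\<^sub>R a j)) \<Longrightarrow> f \<in> polys n"
  unfolding polys_def by (auto simp: fun_eq_iff)

lemma polysE:
  assumes "f \<in> polys n"
  obtains a where "f = (\<lambda>x. \<Sum>j | mi_abs j \<le> n. mi_pow x j *\<^sub>R a j)"
  using assms unfolding polys_def by blast

lemma polys_mono:
  assumes "f \<in> polys m" "m \<le> n"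
  shows "f \<in> polys n"
proof -
  obtain a where a: "f = (\<lambda>x. \<Sum>j | mi_abs j \<le> m. mi_pow x j *\<^sub>R a j)" by (rule polysE[OF assms(1)])
  have "f x = (\<Sum>j | mi_abs j \<le> n. mi_pow x j *\<^sub>R (if mi_abs j \<le> m then a j else 0))" for x
    unfolding a using assms(2)
    by (intro sum.mono_neutral_cong_left) (auto simp: finite_mi_abs_le)
  then show ?thesis by (rule polysI)
qed

lemma polys_scaleR:
  assumes "f \<in> polys n"
  shows "(\<lambda>x. r *\<^sub>R f x) \<in> polys n"
proof -
  obtain a where a: "f = (\<lambda>x. \<Sum>j | mi_abs j \<le> n. mi_pow x j *\<^sub>R a j)" by (rule polysE[OF assms])
  have "r *\<^sub>R f x = (\<Sum>j | mi_abs j \<le> n. mi_pow x j *\<^sub>R (r *\<^sub>R a j))" for x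
    unfolding a by (simp add: scaleR_sum_right mult.commute)
  then show ?thesis by (rule polysI)
qed

lemma polys_add:
  assumes "f \<in> polys n" "g \<in> polys n"
  shows "(\<lambda>x. f x + g x) \<in> polys n"
proof -
  obtain a where a: "f = (\<lambda>x. \<Sum>j | mi_abs j \<le> n. mi_pow x j *\<^sub>R a j)" by (rule polysE[OF assms(1)])
  obtain b where b: "g = (\<lambda>x. \<Sum>j | mi_abs j \<le> n. mi_pow x j *\<^sub>R b j)" by (rule polysE[OF assms(2)])
  have "f x + g x = (\<Sum>j | mi_abs j \<le> n. mi_pow x j *\<^sub>R (a j + b j))" for x
    unfolding a b by (simp add: scaleR_add_right sum.distrib)
  then show ?thesis by (rule polysI)
qed

lemma polys_const: "(\<lambda>x. c) \<in> polys n"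
proof -
  have "c = (\<Sum>j | mi_abs j \<le> n. mi_pow x j *\<^sub>R (if j = (\<lambda>_. 0) then c else 0))" for x :: "real^'a"
  proof -
    have "mi_pow x j *\<^sub>R (if j = (\<lambda>_. 0) then c else 0) = (if j = (\<lambda>_. 0) then c else 0)" for j
      by (simp add: mi_pow_def)
    \<comment> \<open>Summing leaves the question whether the multi-index \<open>0\<close> is in the range.\<close>
    then show ?thesis by (simp add: finite_mi_abs_le) (simp add: mi_abs_def)
  qed
  then show ?thesis by (rule polysI)
qed

lemma polys_sum:
  assumes "\<And>j. j \<in> A \<Longrightarrow> f j \<in> polys n"
  shows "(\<lambda>x. \<Sum>j\<in>A. f j x) \<in> polys n"
  using assms by (induction A rule: infinite_finite_induct) (simp_all add: polys_const polys_add)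

lemma mi_pow_upd_Suc: "mi_pow x (j(i := Suc (j i))) = x $ i * mi_pow x j"
proof -
  have "mi_pow x (j(i := Suc (j i))) = (x $ i) ^ Suc (j i) * (\<Prod>k\<in>UNIV - {i}. (x $ k) ^ j k)"
    unfolding mi_pow_def by (subst prod.remove[of UNIV i]) auto
  also have "\<dots> = x $ i * mi_pow x j"
    using prod.remove[of UNIV i "\<lambda>k. (x $ k) ^ j k"] by (simp add: mi_pow_def)
  finally show ?thesis .
qed

lemma polys_coordinate:
  assumes "f \<in> polys n"
  shows "(\<lambda>x. (x $ i) *\<^sub>R f x) \<in> polys (Suc n)"
proof -
  obtain a where a: "f = (\<lambda>x. \<Sum>j | mi_abs j \<le> n. mi_pow x j *\<^sub>R a j)" by (rule polysE[OF assms])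
  have "(x $ i) *\<^sub>R f x = (\<Sum>j | mi_abs j \<le> Suc n.
      mi_pow x j *\<^sub>R (if j i = 0 then 0 else a (j(i := j i - 1))))" for x
  proof -
    have pred: "mi_abs (j(i := j i - Suc 0)) \<le> n" if "mi_abs j \<le> Suc n" "0 < j i" for j
      using that mi_abs_upd_pred[of j i] by simp
    have "(x $ i) *\<^sub>R f x = (\<Sum>j | mi_abs j \<le> n. mi_pow x (j(i := Suc (j i))) *\<^sub>R a j)"
      by (simp add: a scaleR_sum_right mi_pow_upd_Suc)
    also have "\<dots> = (\<Sum>j | mi_abs j \<le> Suc n \<and> j i \<noteq> 0. mi_pow x j *\<^sub>R a (j(i := j i - 1)))"
      by (rule sum.reindex_bij_witness[of _ "\<lambda>j. j(i := j i - 1)" "\<lambda>j. j(i := Suc (j i))"])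
         (auto simp: mi_abs_upd_Suc pred)
    also have "\<dots> = (\<Sum>j | mi_abs j \<le> Suc n.
        mi_pow x j *\<^sub>R (if j i = 0 then 0 else a (j(i := j i - 1))))"
      by (rule sum.mono_neutral_cong_left) (auto simp: finite_mi_abs_le)
    finally show ?thesis .
  qed
  then show ?thesis by (rule polysI)
qed

lemma polys_mi_pow_diff: "(\<lambda>x. mi_pow (x - x0) j *\<^sub>R v) \<in> polys (mi_abs j)"
proof (induction "mi_abs j" arbitrary: j)
  case 0
  then have "j = (\<lambda>_. 0)" by (auto simp: mi_abs_def)
  then show ?case by (simp add: mi_pow_def polys_const)
next
  case (Suc m)
  then obtain i where "j i \<noteq> 0" by (force simp: mi_abs_def)
  define k where "k = j(i := j i - 1)"
  have j: "j = k(i := Suc (k i))" using \<open>j i \<noteq> 0\<close> by (auto simp: k_def)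
  then have abs: "mi_abs j = Suc (mi_abs k)" by (metis mi_abs_upd_Suc)
  let ?f = "\<lambda>x. mi_pow (x - x0) k *\<^sub>R v"
  have f: "?f \<in> polys (mi_abs k)" using Suc(1)[of k] Suc(2) abs by simp
  have "(\<lambda>x. mi_pow (x - x0) j *\<^sub>R v) = (\<lambda>x. (x $ i) *\<^sub>R ?f x + (- (x0 $ i)) *\<^sub>R ?f x)"
    by (subst j) (simp add: mi_pow_upd_Suc algebra_simps)
  also have "\<dots> \<in> polys (mi_abs j)"
    unfolding abs by (intro polys_add polys_coordinate[OF f] polys_scaleR polys_mono[OF f]) simp
  finally show ?case .
qed

lemma taylor_sum_in_polys: "taylor_sum n a x0 \<in> polys n"
proof -
  have "(\<lambda>x. mi_pow (x - x0) j *\<^sub>R ((1 / mi_fact j) *\<^sub>R a j)) \<in> polys n" if "mi_abs j \<le> n" for j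
    using polys_mono[OF polys_mi_pow_diff that] .
  then have "(\<lambda>x. \<Sum>j | mi_abs j \<le> n. mi_pow (x - x0) j *\<^sub>R ((1 / mi_fact j) *\<^sub>R a j)) \<in> polys n"
    by (intro polys_sum) auto
  then show ?thesis by (simp add: taylor_sum_def[abs_def] scaled_monomial_def)
qed

section \<open>The Taylor polynomial of a solution is quasi-Trefftz\<close>

text \<open>
  Derivatives of a Taylor sum at its centre are its coefficients. They are the derivatives of
  \<open>u\<close> for a multi-index, and coincide with those along an arbitrary list of directions by symmetry.
\<close>

lemma taylor_remainder_vanishes:
  fixes u :: "real^'d::finite \<Rightarrow> 'k::{real_normed_field, euclidean_space}"
  assumes U: "open U" "x0 \<in> U" and u: "Cn_on m U u" and "p \<le> m"
  shows "Cn_on m U (\<lambda>x. taylor p x0 u x + - u x)"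
    "length is \<le> p \<Longrightarrow> partials is (\<lambda>x. taylor p x0 u x + - u x) x0 = 0"
proof -
  define a where "a = (\<lambda>j. if mi_abs j \<le> p then mi_partial j u x0 else 0)"
  have T: "taylor p x0 u = taylor_sum p a x0" by (simp add: taylor_eq_taylor_sum a_def)
  have a: "\<And>j. p < mi_abs j \<Longrightarrow> a j = 0" by (simp add: a_def)
  have CT: "Cn_on m U (taylor p x0 u)" unfolding T by (rule Cn_on_taylor_sum[OF U(1) a])
  have Cu: "Cn_on m U (\<lambda>x. - u x)" 
    by (rule Cn_on_bounded_linear[OF U(1) bounded_linear_minus[OF bounded_linear_ident] u])
  show "Cn_on m U (\<lambda>x. taylor p x0 u x + - u x)"
    by (rule Cn_on_add[OF U(1) CT Cu])
  assume le: "length is \<le> p"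
  have lem: "length is \<le> m" using le assms(4) by simp
  have "partials is (taylor p x0 u) x0 = a (count_list is)"
    by (simp add: T partials_taylor_sum[OF a] taylor_sum_at_center)
  also have "\<dots> = partials is u x0"
    using le mi_partial_eq_partials[OF U(1) u lem U(2)] by (simp add: a_def flip: length_eq_mi_abs)
  finally show "partials is (\<lambda>x. taylor p x0 u x + - u x) x0 = 0"
    using partials_add[OF U(1) CT Cu lem U(2)]
      partials_bounded_linear[OF U(1) bounded_linear_minus[OF bounded_linear_ident] u lem U(2)]
    by simp
qed

lemma diff_op_add:
  fixes f g :: "real^'d::finite \<Rightarrow> 'k::{real_normed_field, euclidean_space}"
  assumes "open U" "Cn_on \<gamma> U f" "Cn_on \<gamma> U g" "x \<in> U"
  shows "diff_op \<gamma> c (\<lambda>x. f x + g x) x = diff_op \<gamma> c f x + diff_op \<gamma> c g x"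
proof -
  have "mi_partial j (\<lambda>x. f x + g x) x = mi_partial j f x + mi_partial j g x" if "mi_abs j \<le> \<gamma>" for j
  proof -
    obtain js where js: "length js = mi_abs j" "\<And>f :: real^'d \<Rightarrow> 'k. mi_partial j f = partials js f"
      by (rule mi_partial_as_partials[where ?'d = 'd and ?'k = 'k and j = j]) (rule that)
    show ?thesis unfolding js(2) using partials_add[OF assms(1-3) _ assms(4)] js(1) that by simp
  qed
  then show ?thesis
    unfolding diff_op_def sum_over_orders by (simp add: distrib_left flip: sum.distrib)
qed

text \<open>
  Each derivative in the operator costs at most \<open>\<gamma>\<close> orders of vanishing, and multiplication by a
  \<open>C\<^sup>p\<^sup>-\<^sup>\<gamma>\<close> coefficient costs none of the \<open>p - \<gamma>\<close> that remain.
\<close>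

lemma vanishes_to_order_diff_op:
  fixes f :: "real^'d::finite \<Rightarrow> 'k::{real_normed_field, euclidean_space}"
  assumes U: "open U" "x0 \<in> U" and f: "vanishes_to_order p U x0 f" and "\<gamma> \<le> p"
    and c: "\<And>j. mi_abs j \<le> \<gamma> \<Longrightarrow> Cn_on (p - \<gamma>) U (c j)"
  shows "vanishes_to_order (p - \<gamma>) U x0 (diff_op \<gamma> c f)"
  unfolding diff_op_def sum_over_orders
proof (intro vanishes_to_order_sum[OF U] vanishes_to_order_mult[OF U])
  fix j :: "'d \<Rightarrow> nat" assume "j \<in> {j. mi_abs j \<le> \<gamma>}"
  then have j: "mi_abs j \<le> \<gamma>" by simp
  then show "Cn_on (p - \<gamma>) U (c j)" by (rule c)
  obtain js where js: "length js = mi_abs j" "\<And>f :: real^'d \<Rightarrow> 'k. mi_partial j f = partials js f"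
    by (rule mi_partial_as_partials[where ?'d = 'd and ?'k = 'k and j = j]) (rule that)
  show "vanishes_to_order (p - \<gamma>) U x0 (mi_partial j f)"
    unfolding js(2) using j js(1) \<open>\<gamma> \<le> p\<close>
    by (intro vanishes_to_order_partials vanishes_to_order_mono[OF f]) simp
qed

text \<open>
  With \<open>w\<close> the difference of the Taylor polynomial and \<open>u\<close>, the operator takes the same values on
  the Taylor polynomial and on \<open>w\<close> near \<open>x0\<close>, because it annihilates \<open>u\<close> there. The function \<open>w\<close>
  vanishes to order \<open>p\<close>, hence its image vanishes to order \<open>p - \<gamma>\<close>.
\<close>

lemma taylor_in_quasi_trefftz:
  fixes u :: "real^'d::finite \<Rightarrow> 'k::{real_normed_field, euclidean_space}"
  assumes "\<gamma> \<le> p" and c: "\<And>j. mi_abs j \<le> \<gamma> \<Longrightarrow> c j \<in> Cn (p - \<gamma>) x0"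
    and u: "u \<in> Cn p x0" and Lu: "\<forall>\<^sub>F x in nhds x0. diff_op \<gamma> c u x = 0"
  shows "taylor p x0 u \<in> quasi_trefftz p \<gamma> c x0"
proof -
  obtain U where U: "open U" "x0 \<in> U" "Cn_on p U u" using u by (auto simp: Cn_def)
  obtain W where W: "open W" "x0 \<in> W" "\<And>x. x \<in> W \<Longrightarrow> diff_op \<gamma> c u x = 0"
    using Lu by (auto simp: eventually_nhds)
  have "\<forall>j\<in>{j. mi_abs j \<le> \<gamma>}. \<exists>V. open V \<and> x0 \<in> V \<and> Cn_on (p - \<gamma>) V (c j)"
    using c by (auto simp: Cn_def)
  then obtain V where V: "\<And>j. mi_abs j \<le> \<gamma> \<Longrightarrow> open (V j) \<and> x0 \<in> V j \<and> Cn_on (p - \<gamma>) (V j) (c j)"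
    by (metis mem_Collect_eq)
  \<comment> \<open>Only finitely many coefficients occur, so their neighbourhoods have a common one.\<close>
  define N where "N = U \<inter> W \<inter> (\<Inter>j\<in>{j. mi_abs j \<le> \<gamma>}. V j)"
  have N: "open N" "x0 \<in> N"
    unfolding N_def using U W V by (auto intro!: open_Int open_INT simp: finite_mi_abs_le)
  have uN: "Cn_on p N u" by (rule Cn_on_subset[OF U(3)]) (auto simp: N_def)
  have cN: "Cn_on (p - \<gamma>) N (c j)" if "mi_abs j \<le> \<gamma>" for j
    by (rule Cn_on_subset[of _ "V j"]) (use V that in \<open>auto simp: N_def\<close>)
  define w where "w = (\<lambda>x. taylor p x0 u x + - u x)"
  have w: "vanishes_to_order p N x0 w"
    using taylor_remainder_vanishes[OF N uN] by (simp add: vanishes_to_order_def w_def)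
  have "Cn_on \<gamma> N u" "Cn_on \<gamma> N w"
    using Cn_on_mono[OF uN \<open>\<gamma> \<le> p\<close>] vanishes_to_order_mono[OF w \<open>\<gamma> \<le> p\<close>]
    by (simp_all add: vanishes_to_order_def)
  then have "diff_op \<gamma> c (\<lambda>x. u x + w x) x = diff_op \<gamma> c u x + diff_op \<gamma> c w x" if "x \<in> N" for x
    using that by (rule diff_op_add[OF N(1)])
  moreover have "diff_op \<gamma> c u x = 0" if "x \<in> N" for x
    using that by (intro W(3)) (simp add: N_def)
  moreover have "(\<lambda>x. u x + w x) = taylor p x0 u" by (auto simp: w_def)
  ultimately have "vanishes_to_order (p - \<gamma>) N x0 (diff_op \<gamma> c (taylor p x0 u))"
    using vanishes_to_order_cong_open[OF N vanishes_to_order_diff_op[OF N w \<open>\<gamma> \<le> p\<close> cN]] by simp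
  then have "mi_partial j (diff_op \<gamma> c (taylor p x0 u)) x0 = 0" if "mi_abs j \<le> p - \<gamma>" for j
    using mi_partial_as_partials[where ?'d = 'd and ?'k = 'k and j = j] that
    unfolding vanishes_to_order_def by metis
  then have "taylor (p - \<gamma>) x0 (diff_op \<gamma> c (taylor p x0 u)) = (\<lambda>x. 0)"
    by (simp add: taylor_eq_taylor_sum taylor_sum_def[abs_def])
  moreover have "taylor p x0 u \<in> polys p"
    by (simp add: taylor_eq_taylor_sum taylor_sum_in_polys)
  ultimately show ?thesis by (simp add: quasi_trefftz_def)
qed

text \<open>
  The derivatives of the remainder of order less than \<open>p + 1\<close> vanish at \<open>x0\<close>, and so do those of its
  partial derivatives of order less than \<open>p\<close>. Both estimates are thus instances of one growth lemma.
\<close>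

lemma taylor_remainder_bounds:
  fixes u :: "real^'d::finite \<Rightarrow> 'k::{real_normed_field, euclidean_space}"
  assumes "u \<in> Cn (Suc p) x0"
  shows "\<exists>C. \<forall>\<^sub>F x in nhds x0. norm (u x - taylor p x0 u x) \<le> C * norm (x - x0) ^ (p + 1) \<and>
       norm (grad u x - grad (taylor p x0 u) x) \<le> C * norm (x - x0) ^ p"
proof -
  obtain U where U: "open U" "x0 \<in> U" and u: "Cn_on (Suc p) U u" using assms by (auto simp: Cn_def)
  define w where "w = (\<lambda>x. taylor p x0 u x + - u x)"
  have w: "Cn_on (Suc p) U w" "\<And>is. length is \<le> p \<Longrightarrow> partials is w x0 = 0"
    using taylor_remainder_vanishes[OF U u] by (simp_all add: w_def)
  obtain A where A: "\<forall>\<^sub>F x in nhds x0. norm (w x) \<le> A * norm (x - x0) ^ Suc p"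
    using eventually_norm_le_power[OF U w(1)] w(2) by auto
  have "\<exists>B. \<forall>\<^sub>F x in nhds x0. norm (partial i w x) \<le> B * norm (x - x0) ^ p" for i
  proof (rule eventually_norm_le_power[OF U])
    show "Cn_on p U (partial i w)" using w(1) by simp
    show "partials is (partial i w) x0 = 0" if "length is < p" for "is"
      using w(2)[of "is @ [i]"] that by simp
  qed
  then obtain B where B: "\<And>i. \<forall>\<^sub>F x in nhds x0. norm (partial i w x) \<le> B i * norm (x - x0) ^ p"
    by metis
  have B': "\<forall>\<^sub>F x in nhds x0. \<forall>i. norm (partial i w x) \<le> B i * norm (x - x0) ^ p"
    by (intro eventually_all_finite B)
  define C where "C = max A (\<Sum>i\<in>UNIV. B i)"
  have "\<forall>\<^sub>F x in nhds x0. norm (u x - taylor p x0 u x) \<le> C * norm (x - x0) ^ (p + 1) \<and>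
       norm (grad u x - grad (taylor p x0 u) x) \<le> C * norm (x - x0) ^ p"
    using A B' eventually_nhds_in_open[OF U]
  proof eventually_elim
    case (elim x)
    have "norm (u x - taylor p x0 u x) = norm (w x)" by (simp add: w_def norm_minus_commute)
    also have "\<dots> \<le> A * norm (x - x0) ^ (p + 1)" using elim(1) by simp
    also have "\<dots> \<le> C * norm (x - x0) ^ (p + 1)" by (intro mult_right_mono) (auto simp: C_def)
    finally have 1: "norm (u x - taylor p x0 u x) \<le> C * norm (x - x0) ^ (p + 1)" .
    have "partial i (taylor p x0 u) x = partial i u x + partial i w x" for i
    proof -
      have "has_partial i (\<lambda>x. u x + w x) (partial i u x + partial i w x) x"
        using elim(3) by (intro has_partial_add Cn_on_has_partial[OF u] Cn_on_has_partial[OF w(1)])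
      then show ?thesis using has_partialD(2) by (fastforce simp: w_def)
    qed
    then have "norm (grad u x - grad (taylor p x0 u) x) \<le> (\<Sum>i\<in>UNIV. norm (partial i w x))"
      using L2_set_le_sum[of UNIV "\<lambda>i. norm (partial i w x)"] by (simp add: norm_vec_def grad_def)
    also have "\<dots> \<le> (\<Sum>i\<in>UNIV. B i * norm (x - x0) ^ p)" using elim(2) by (intro sum_mono) auto
    also have "\<dots> = (\<Sum>i\<in>UNIV. B i) * norm (x - x0) ^ p" by (simp add: sum_distrib_right)
    also have "\<dots> \<le> C * norm (x - x0) ^ p" by (intro mult_right_mono) (auto simp: C_def)
    finally show ?case using 1 by simp
  qed
  then show ?thesis ..
qed

theorem proposition2:
  fixes x0 :: "real^'d::finite"
    and p :: nat
    and u :: "real^'d \<Rightarrow> 'k::{real_normed_field, euclidean_space}"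
  shows "\<exists>C::real. \<forall>(\<gamma>::nat) (c :: ('d \<Rightarrow> nat) \<Rightarrow> real^'d \<Rightarrow> 'k).
    1 \<le> \<gamma> \<longrightarrow> \<gamma> \<le> p \<longrightarrow>
    (\<forall>j. mi_abs j \<le> \<gamma> \<longrightarrow> c j \<in> Cn (p - \<gamma>) x0) \<longrightarrow>
    u \<in> Cn (p + \<gamma>) x0 \<longrightarrow>
    (\<forall>\<^sub>F x in nhds x0. diff_op \<gamma> c u x = 0) \<longrightarrow>
    (\<exists>ua \<in> quasi_trefftz p \<gamma> c x0. \<forall>\<^sub>F x in nhds x0.
       norm (u x - ua x) \<le> C * norm (x - x0) ^ (p + 1) \<and>
       norm (grad u x - grad ua x) \<le> C * norm (x - x0) ^ p)"
  \<comment> \<open>The constant must be found before \<open>\<gamma>\<close> is known. It exists as soon as \<open>u\<close> is \<open>C\<^sup>p\<^sup>+\<^sup>1\<close>.\<close>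
proof (cases "u \<in> Cn (Suc p) x0")
  case True
  then obtain C where C: "\<forall>\<^sub>F x in nhds x0.
       norm (u x - taylor p x0 u x) \<le> C * norm (x - x0) ^ (p + 1) \<and>
       norm (grad u x - grad (taylor p x0 u) x) \<le> C * norm (x - x0) ^ p"
    using taylor_remainder_bounds by blast
  have "u \<in> Cn p x0" using True Cn_on_Suc_imp unfolding Cn_def by blast
  then have "taylor p x0 u \<in> quasi_trefftz p \<gamma> c x0"
    if "\<gamma> \<le> p" "\<forall>j. mi_abs j \<le> \<gamma> \<longrightarrow> c j \<in> Cn (p - \<gamma>) x0"
      "\<forall>\<^sub>F x in nhds x0. diff_op \<gamma> c u x = 0" for \<gamma> and c :: "('d \<Rightarrow> nat) \<Rightarrow> real^'d \<Rightarrow> 'k"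
    using that by (intro taylor_in_quasi_trefftz) auto
  then show ?thesis using C by blast
next
  case False
  \<comment> \<open>Any \<open>C\<close> will do: the hypothesis on \<open>u\<close> fails for every order \<open>\<gamma> \<ge> 1\<close>.\<close>
  have "u \<notin> Cn (p + \<gamma>) x0" if "1 \<le> \<gamma>" for \<gamma>
  proof
    assume "u \<in> Cn (p + \<gamma>) x0"
    then have "u \<in> Cn (Suc p) x0"
      unfolding Cn_def using Cn_on_mono[of "p + \<gamma>" _ u "Suc p"] that by auto
    with False show False ..
  qed
  then show ?thesis by blast
qed

end
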